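(* Let $G$ be a group of td-type with a fixed left-invariant Haar measure. Let $(\pi,V)$ be a smooth representation of $G$ on a complex vector space such that every $G$-invariant subspace of $V$ has a $G$-invariant complement. Let $K$ be an open-compact subgroup of $G$, and let $v_0\in V^K$ be a non-zero vector with the following properties. (i) The vectors $\pi(g)v_0$, where $g$ runs through $G$, span $V$. (ii) $v_0$ is an eigenvector for the Hecke algebra $\mathcal{H}(G,K)$. Then the representation $\pi$ is irreducible.
   Context: A group of td-type is a Hausdorff topological group in which every neighborhood of the identity contains an open-compact subgroup. A representation $\pi$ of $G$ on a complex vector space $V$ is smooth if every $v\in V$ is stabilized by some open-compact subgroup of $G$. $V^K$ is the space of $K$-invariant vectors. $\mathcal{H}(G,K)$ is the algebra of compactly supported, left and right $K$-invariant functions $f:G\to\mathbb{C}$ under convolution $(f_1*f_2)(g)=\int_G f_1(h)f_2(h^{-1}g)\,dh$. It acts on $V^K$ by $\pi(f)v=\int_G f(g)\pi(g)v\,dg$. A vector $v\in V^K$ is an eigenvector for $\mathcal{H}(G,K)$ if for every $f\in\mathcal{H}(G,K)$ there is a scalar $\lambda(f)\in\mathbb{C}$ with $\pi(f)v=\lambda(f)v$. *)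

theory Defs
  imports "HOL-Analysis.Analysis" "HOL-Algebra.Coset" "HOL-Algebra.Ring"
begin

locale topological_group = group G for G (structure) +
  fixes T :: "'a topology"
  assumes topspace_eq_carrier: "topspace T = carrier G"
    and continuous_mult: "continuous_map (prod_topology T T) T (\<lambda>(x, y). x \<otimes> y)"
    and continuous_inv: "continuous_map T T (\<lambda>x. inv x)"

definition open_compact_subgroup ::
    "('g, 'm) monoid_scheme \<Rightarrow> 'g topology \<Rightarrow> 'g set \<Rightarrow> bool" where
  "open_compact_subgroup G T K \<longleftrightarrow> subgroup K G \<and> openin T K \<and> compactin T K"

locale td_group = topological_group +
  assumes hausdorff: "Hausdorff_space T"
    and small_open_compact_subgroups:
      "openin T U \<Longrightarrow> \<one> \<in> U \<Longrightarrow> \<exists>K. open_compact_subgroup G T K \<and> K \<subseteq> U"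

text \<open>A left Haar measure is a nonzero left-invariant Radon measure on the Borel sets. Radon means
  finite on compact sets, outer regular on Borel sets and inner regular on open sets.\<close>

locale left_haar_measure = topological_group +
  fixes \<mu> :: "'a measure"
  assumes space_eq: "space \<mu> = carrier G"
    and sets_eq: "sets \<mu> = sigma_sets (carrier G) {U. openin T U}"
    and nonzero: "emeasure \<mu> (carrier G) \<noteq> 0"
    and left_invariant:
      "g \<in> carrier G \<Longrightarrow> A \<in> sets \<mu> \<Longrightarrow> emeasure \<mu> (g <# A) = emeasure \<mu> A"
    and finite_on_compact: "compactin T C \<Longrightarrow> emeasure \<mu> C < \<infinity>"
    and outer_regular:
      "A \<in> sets \<mu> \<Longrightarrow> emeasure \<mu> A = (INF U\<in>{U. openin T U \<and> A \<subseteq> U}. emeasure \<mu> U)"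
    and inner_regular:
      "openin T U \<Longrightarrow> emeasure \<mu> U = (SUP C\<in>{C. compactin T C \<and> C \<subseteq> U}. emeasure \<mu> C)"

text \<open>Functions on the group are functions on the ambient type that vanish off the carrier. The
  unit is the normalised indicator function of \<open>K\<close>; scalars act pointwise.\<close>

definition hecke_algebra ::
    "('g, 'm) monoid_scheme \<Rightarrow> 'g topology \<Rightarrow> 'g measure \<Rightarrow> 'g set \<Rightarrow> ('g \<Rightarrow> complex) ring" where
  "hecke_algebra G T \<mu> K =
    \<lparr> carrier = {f. {g. f g \<noteq> 0} \<subseteq> carrier G \<and>
                    compactin T (T closure_of {g. f g \<noteq> 0}) \<and>
                    (\<forall>k\<in>K. \<forall>g\<in>carrier G. f (k \<otimes>\<^bsub>G\<^esub> g) = f g \<and> f (g \<otimes>\<^bsub>G\<^esub> k) = f g)},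
      mult = (\<lambda>f\<^sub>1 f\<^sub>2 g. if g \<in> carrier G
                      then LINT h|\<mu>. f\<^sub>1 h * f\<^sub>2 (inv\<^bsub>G\<^esub> h \<otimes>\<^bsub>G\<^esub> g) else 0),
      one = (\<lambda>g. if g \<in> K then of_real (1 / measure \<mu> K) else 0),
      zero = (\<lambda>g. 0),
      add = (\<lambda>f\<^sub>1 f\<^sub>2 g. f\<^sub>1 g + f\<^sub>2 g) \<rparr>"

locale representation = group G + vector_space scale
  for G (structure) and scale :: "complex \<Rightarrow> 'v::ab_group_add \<Rightarrow> 'v" +
  fixes \<pi> :: "'a \<Rightarrow> 'v \<Rightarrow> 'v"
  assumes linear_rep: "g \<in> carrier G \<Longrightarrow> Vector_Spaces.linear scale scale (\<pi> g)"
    and rep_one: "\<pi> \<one> v = v"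
    and rep_mult: "g \<in> carrier G \<Longrightarrow> h \<in> carrier G \<Longrightarrow> \<pi> (g \<otimes> h) v = \<pi> g (\<pi> h v)"
begin

definition invariant_subspace :: "'v set \<Rightarrow> bool" where
  "invariant_subspace W \<longleftrightarrow> subspace W \<and> (\<forall>g\<in>carrier G. \<forall>w\<in>W. \<pi> g w \<in> W)"

definition irreducible :: bool where
  "irreducible \<longleftrightarrow> (UNIV :: 'v set) \<noteq> {0} \<and>
     (\<forall>W. invariant_subspace W \<longrightarrow> W = {0} \<or> W = UNIV)"

definition has_invariant_complements :: bool where
  "has_invariant_complements \<longleftrightarrow>
     (\<forall>W. invariant_subspace W \<longrightarrow>
       (\<exists>W'. invariant_subspace W' \<and> W \<inter> W' = {0} \<and> {w + w' | w w'. w \<in> W \<and> w' \<in> W'} = UNIV))"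

definition fixed_vectors :: "'a set \<Rightarrow> 'v set" where
  "fixed_vectors K = {v. \<forall>k\<in>K. \<pi> k v = v}"

text \<open>As \<open>V\<close> carries no topology, the vector-valued integral is the finite sum, over the nonzero
  values \<open>w\<close> of \<open>\<phi>\<close>, of \<open>w\<close> times the measure of its level set. It is meant for locally constant
  compactly supported \<open>\<phi>\<close>, which take only finitely many values on level sets of finite measure.\<close>

definition vector_integral :: "'a measure \<Rightarrow> ('a \<Rightarrow> 'v) \<Rightarrow> 'v" where
  "vector_integral \<mu> \<phi> =
     (\<Sum>w\<in>\<phi> ` space \<mu> - {0}. scale (of_real (measure \<mu> {g \<in> space \<mu>. \<phi> g = w})) w)"

definition hecke_action :: "'a measure \<Rightarrow> ('a \<Rightarrow> complex) \<Rightarrow> 'v \<Rightarrow> 'v" where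
  "hecke_action \<mu> f v = vector_integral \<mu> (\<lambda>g. scale (f g) (\<pi> g v))"

definition hecke_eigenvector :: "'a topology \<Rightarrow> 'a measure \<Rightarrow> 'a set \<Rightarrow> 'v \<Rightarrow> bool" where
  "hecke_eigenvector T \<mu> K v \<longleftrightarrow> v \<in> fixed_vectors K \<and>
     (\<forall>f\<in>carrier (hecke_algebra G T \<mu> K). \<exists>c. hecke_action \<mu> f v = scale c v)"

end

locale smooth_representation = representation +
  fixes T :: "'a topology"
  assumes smooth: "\<exists>K. open_compact_subgroup G T K \<and> v \<in> fixed_vectors K"

end

theory Submission imports Defs begin

text \<open>Averaging \<open>\<pi>(g) v\<^sub>0\<close> over \<open>K\<close> amounts to applying the Hecke operator of \<open>KgK\<close> to \<open>v\<^sub>0\<close>, so it gives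
  a multiple of \<open>v\<^sub>0\<close>; as these vectors span \<open>V\<close>, the space \<open>V\<^sup>K\<close> is the line through \<open>v\<^sub>0\<close>. If
  \<open>V = W \<oplus> W'\<close> is an invariant decomposition, the component of \<open>v\<^sub>0\<close> in \<open>W\<close> is \<open>K\<close>-fixed, hence a
  multiple of \<open>v\<^sub>0\<close>. So \<open>v\<^sub>0\<close> lies in \<open>W\<close> or in \<open>W'\<close>, and that summand is all of \<open>V\<close>.\<close>

section \<open>Translates and double cosets in a topological group\<close>

context topological_group
begin

lemma continuous_map_left_translation:
  assumes "g \<in> carrier G"
  shows "continuous_map T T (\<lambda>x. g \<otimes> x)"
proof -
  have "continuous_map T (prod_topology T T) (\<lambda>x. (g, x))"
    using assms by (simp add: continuous_map_pairedI topspace_eq_carrier)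
  from continuous_map_compose[OF this continuous_mult] show ?thesis
    by (simp add: o_def)
qed

lemma l_coset_eq_vimage:
  assumes "g \<in> carrier G" "U \<subseteq> carrier G"
  shows "g <# U = {x \<in> carrier G. inv g \<otimes> x \<in> U}"
proof (intro equalityI subsetI)
  fix x assume "x \<in> g <# U"
  then obtain u where "u \<in> U" "x = g \<otimes> u" by (auto simp: l_coset_def)
  moreover have "u \<in> carrier G" using \<open>u \<in> U\<close> assms by auto
  ultimately show "x \<in> {x \<in> carrier G. inv g \<otimes> x \<in> U}"
    using assms by (simp add: m_assoc[symmetric])
next
  fix x assume x: "x \<in> {x \<in> carrier G. inv g \<otimes> x \<in> U}"
  then have "x = g \<otimes> (inv g \<otimes> x)" using assms by (simp add: m_assoc[symmetric])
  with x show "x \<in> g <# U" by (auto simp: l_coset_def)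
qed

lemma openin_l_coset:
  assumes "g \<in> carrier G" "openin T U"
  shows "openin T (g <# U)"
proof -
  have "U \<subseteq> carrier G" using openin_subset[OF assms(2)] by (simp add: topspace_eq_carrier)
  moreover have "openin T {x \<in> topspace T. inv g \<otimes> x \<in> U}"
    using continuous_map_left_translation[of "inv g"] assms
    by (intro openin_continuous_map_preimage) auto
  ultimately show ?thesis using assms by (simp add: l_coset_eq_vimage topspace_eq_carrier)
qed

text \<open>Continuous image of a product of compact sets. With \<open>A = B = K\<close> it gives
  compactness of \<open>KgK\<close>, the support of the Hecke function used below.\<close>

lemma compactin_double_coset:
  assumes "g \<in> carrier G" "compactin T A" "compactin T B"
  shows "compactin T ((\<lambda>(x, y). x \<otimes> (g \<otimes> y)) ` (A \<times> B))"
proof -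
  have "continuous_map (prod_topology T T) (prod_topology T T) (\<lambda>p. (fst p, g \<otimes> snd p))"
    using continuous_map_compose[OF continuous_map_snd continuous_map_left_translation[OF assms(1)]]
    by (intro continuous_map_pairedI continuous_map_fst) (simp add: o_def)
  from continuous_map_compose[OF this continuous_mult]
  have "continuous_map (prod_topology T T) T (\<lambda>(x, y). x \<otimes> (g \<otimes> y))"
    by (simp add: o_def case_prod_unfold)
  moreover have "compactin (prod_topology T T) (A \<times> B)"
    using assms by (simp add: compactin_Times)
  ultimately show ?thesis using image_compactin by blast
qed

end

section \<open>Positivity of Haar measure on open sets\<close>

lemma (in left_haar_measure) openin_sets:
  assumes "openin T U"
  shows "U \<in> sets \<mu>"
  using assms by (simp add: sets_eq)

text \<open>If \<open>U\<close> were null, finitely many null translates of \<open>U\<close> would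
  cover any compact set; inner regularity would then make the whole group null.\<close>

lemma (in left_haar_measure) emeasure_open_pos:
  assumes U: "openin T U" "U \<noteq> {}"
  shows "emeasure \<mu> U > 0"
proof (rule ccontr)
  assume "\<not> emeasure \<mu> U > 0"
  then have U0: "emeasure \<mu> U = 0" by simp
  have Uc: "U \<subseteq> carrier G" using openin_subset[OF U(1)] by (simp add: topspace_eq_carrier)
  obtain u where u: "u \<in> U" using U by auto
  have "emeasure \<mu> C = 0" if C: "compactin T C" for C
  proof -
    have Cc: "C \<subseteq> carrier G"
      using compactin_subset_topspace[OF C] by (simp add: topspace_eq_carrier)
    \<comment> \<open>Translation by \<open>c \<otimes> inv u\<close> moves the chosen point
      \<open>u\<close> of \<open>U\<close> to \<open>c\<close>.\<close>
    have "C \<subseteq> (\<Union>c\<in>C. (c \<otimes> inv u) <# U)"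
    proof
      fix c assume c: "c \<in> C"
      have "c = (c \<otimes> inv u) \<otimes> u" using c Cc u Uc by (auto simp: m_assoc subset_eq)
      then show "c \<in> (\<Union>c\<in>C. (c \<otimes> inv u) <# U)" using c u by (force simp: l_coset_def)
    qed
    moreover have op: "openin T ((c \<otimes> inv u) <# U)" if "c \<in> C" for c
      using that Cc u Uc U by (intro openin_l_coset) auto
    ultimately obtain \<F> where \<F>: "finite \<F>" "\<F> \<subseteq> (\<lambda>c. (c \<otimes> inv u) <# U) ` C" "C \<subseteq> \<Union>\<F>"
      using C[unfolded compactin_def]
      by (elim conjE allE[of _ "(\<lambda>c. (c \<otimes> inv u) <# U) ` C"]) auto
    have null: "V \<in> null_sets \<mu>" if "V \<in> \<F>" for V
    proof -
      obtain c where c: "c \<in> C" "V = (c \<otimes> inv u) <# U" using \<F>(2) \<open>V \<in> \<F>\<close> by blast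
      have "c \<otimes> inv u \<in> carrier G" using c(1) Cc u Uc by blast
      then have "emeasure \<mu> V = emeasure \<mu> U"
        unfolding c(2) using openin_sets[OF U(1)] by (rule left_invariant)
      then show ?thesis using U0 op c openin_sets by (auto simp: null_sets_def)
    qed
    have "\<Union>\<F> \<in> null_sets \<mu>"
      using null_sets.finite_UN[OF \<F>(1), of "\<lambda>V. V" \<mu>] null by auto
    then show ?thesis
      using emeasure_mono[OF \<F>(3), of \<mu>] by (auto simp: null_sets_def)
  qed
  then have "(SUP C\<in>{C. compactin T C \<and> C \<subseteq> carrier G}. emeasure \<mu> C) \<le> 0"
    by (intro SUP_least) auto
  moreover have "openin T (carrier G)" using openin_topspace[of T] by (simp add: topspace_eq_carrier)
  ultimately show False using inner_regular[of "carrier G"] nonzero by simp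
qed

section \<open>Averaging over a subgroup, and irreducibility from a line of fixed vectors\<close>

context representation
begin

lemma rep_inverse:
  assumes "g \<in> carrier G"
  shows "\<pi> (inv g) (\<pi> g v) = v" "\<pi> g (\<pi> (inv g) v) = v"
  using assms rep_mult[of "inv g" g v] rep_mult[of g "inv g" v] rep_one by auto

lemma rep_zero:
  assumes "g \<in> carrier G"
  shows "\<pi> g 0 = 0"
  using Vector_Spaces.linear.axioms(3)[OF linear_rep[OF assms]] module_hom.zero by blast

lemma rep_add:
  assumes "g \<in> carrier G"
  shows "\<pi> g (v + w) = \<pi> g v + \<pi> g w"
  using Vector_Spaces.linear.axioms(3)[OF linear_rep[OF assms]] module_hom.add by blast

lemma rep_scale:
  assumes "g \<in> carrier G"
  shows "\<pi> g (scale c v) = scale c (\<pi> g v)"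
  using Vector_Spaces.linear.axioms(3)[OF linear_rep[OF assms]] module_hom.scale by blast

lemma rep_sum:
  assumes "g \<in> carrier G"
  shows "\<pi> g (sum f A) = (\<Sum>a\<in>A. \<pi> g (f a))"
  using Vector_Spaces.linear.axioms(3)[OF linear_rep[OF assms]] module_hom.sum by blast

lemma rep_eq_zero_iff:
  assumes "g \<in> carrier G"
  shows "\<pi> g v = 0 \<longleftrightarrow> v = 0"
  using rep_inverse(1)[OF assms, of v] rep_zero assms by (metis inv_closed)

lemma bij_betw_rep_orbit:
  assumes "subgroup K G" "k \<in> K"
  shows "bij_betw (\<pi> k) ((\<lambda>j. \<pi> j v) ` K) ((\<lambda>j. \<pi> j v) ` K)"
proof (rule bij_betw_byWitness[where f' = "\<pi> (inv k)"])
  interpret K: subgroup K G by fact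
  have orb: "\<pi> h ` (\<lambda>j. \<pi> j v) ` K \<subseteq> (\<lambda>j. \<pi> j v) ` K" if "h \<in> K" for h
  proof clarify
    fix j assume "j \<in> K"
    then have "\<pi> h (\<pi> j v) = \<pi> (h \<otimes> j) v" using that by (simp add: rep_mult)
    then show "\<pi> h (\<pi> j v) \<in> (\<lambda>j. \<pi> j v) ` K" using that \<open>j \<in> K\<close> by blast
  qed
  show "\<pi> k ` (\<lambda>j. \<pi> j v) ` K \<subseteq> (\<lambda>j. \<pi> j v) ` K"
    "\<pi> (inv k) ` (\<lambda>j. \<pi> j v) ` K \<subseteq> (\<lambda>j. \<pi> j v) ` K"
    using orb assms(2) by blast+
qed (use assms(2) rep_inverse subgroup.mem_carrier[OF assms(1)] in auto)

text \<open>A \<open>K\<close>-fixed vector is its own average over the finite group of permutations that \<open>K\<close> induces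
  on the orbits of the spanning vectors occurring in it, and averaging a spanning vector gives a
  multiple of its orbit sum.\<close>

lemma fixed_vector_in_subspace:
  assumes K: "subgroup K G"
    and fin: "\<And>b. b \<in> B \<Longrightarrow> finite ((\<lambda>k. \<pi> k b) ` K)"
    and orbit_sum: "\<And>b. b \<in> B \<Longrightarrow> (\<Sum>u\<in>(\<lambda>k. \<pi> k b) ` K. u) \<in> M"
    and M: "subspace M"
    and w: "w \<in> span B" "w \<in> fixed_vectors K"
  shows "w \<in> M"
proof -
  interpret K: subgroup K G by fact
  obtain t c where t: "finite t" "t \<subseteq> B" "w = (\<Sum>a\<in>t. scale (c a) a)"
    using w(1) unfolding span_explicit by auto
  define orb where "orb b = (\<lambda>k. \<pi> k b) ` K" for b
  define U where "U = (\<Union>a\<in>t. orb a)"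
  \<comment> \<open>\<open>K\<close> itself may be infinite, but it acts on the finite set
    \<open>U\<close> through finitely many maps. \<open>restrict\<close> makes two of them equal
    once they agree on \<open>U\<close>.\<close>
  define H where "H = (\<lambda>k. restrict (\<pi> k) U) ` K"
  define A where "A u = (\<Sum>h\<in>H. h u)" for u
  have finU: "finite U" using t fin by (auto simp: U_def orb_def)
  have finO: "finite (orb a)" if "a \<in> t" for a using t fin that by (auto simp: orb_def)
  have OU: "orb a \<subseteq> U" if "a \<in> t" for a using that by (auto simp: U_def)
  have self: "a \<in> orb a" for a
    unfolding orb_def by (rule image_eqI[OF _ K.one_closed]) (simp add: rep_one)
  have bijO: "bij_betw (\<pi> k) (orb a) (orb a)" if "k \<in> K" for k a
    unfolding orb_def by (rule bij_betw_rep_orbit[OF K that])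
  have closed: "\<pi> k u \<in> U" if "k \<in> K" "u \<in> U" for k u
    using that bij_betw_apply[OF bijO] unfolding U_def by blast
  have "H \<subseteq> U \<rightarrow>\<^sub>E U" using closed by (auto simp: H_def)
  then have finH: "finite H" using finU by (meson finite_PiE finite_subset)
  have "H \<noteq> {}" using K.one_closed unfolding H_def by blast
  then have cardH: "card H \<noteq> 0" using finH by simp
  \<comment> \<open>Composition on the right with \<pi> \<open>k\<close> permutes \<open>H\<close>,
    so it only reorders the sum \<open>A u\<close>.\<close>
  have A_inv: "A (\<pi> k u) = A u" if k: "k \<in> K" and u: "u \<in> U" for k u
  proof -
    have comp: "restrict (h \<circ> \<pi> j) U \<in> H" if "h \<in> H" "j \<in> K" for h j
    proof -
      obtain i where i: "i \<in> K" "h = restrict (\<pi> i) U" using \<open>h \<in> H\<close> by (auto simp: H_def)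
      have "restrict (h \<circ> \<pi> j) U = restrict (\<pi> (i \<otimes> j)) U"
        using i that closed by (auto simp: fun_eq_iff rep_mult)
      then show ?thesis using i that by (auto simp: H_def)
    qed
    \<comment> \<open>Members of \<open>H\<close> are \<open>undefined\<close> off \<open>U\<close>,
      so this is an equality of functions and not only of values on \<open>U\<close>.\<close>
    have cancel: "restrict (restrict (h \<circ> \<pi> j) U \<circ> \<pi> i) U = h"
      if "h \<in> H" "i \<in> K" "j \<in> K" "\<And>v. \<pi> j (\<pi> i v) = v" for h i j
    proof
      fix u
      have "u \<notin> U \<Longrightarrow> h u = undefined" using that(1) by (auto simp: H_def)
      then show "restrict (restrict (h \<circ> \<pi> j) U \<circ> \<pi> i) U u = h u"
        using closed[OF that(2), of u] by (cases "u \<in> U") (simp_all add: that(4))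
    qed
    have bij: "bij_betw (\<lambda>h. restrict (h \<circ> \<pi> k) U) H H"
      by (rule bij_betw_byWitness[where f' = "\<lambda>h. restrict (h \<circ> \<pi> (inv k)) U"])
        (use comp[OF _ k] comp[OF _ K.m_inv_closed[OF k]]
          cancel[OF _ k K.m_inv_closed[OF k]] cancel[OF _ K.m_inv_closed[OF k] k]
          rep_inverse[OF K.mem_carrier[OF k]] in blast)+
    have "A u = (\<Sum>h\<in>H. restrict (h \<circ> \<pi> k) U u)"
      unfolding A_def using sum.reindex_bij_betw[OF bij, of "\<lambda>h. h u"] by simp
    then show ?thesis using u by (simp add: A_def)
  qed
  have A_M: "A a \<in> M" if a: "a \<in> t" for a
  proof -
    \<comment> \<open>\<open>A\<close> is constant on the orbit of \<open>a\<close>, and every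
      \<open>h\<close> in \<open>H\<close> permutes that orbit. Summing \<open>A\<close> over the
      orbit therefore gives the orbit sum once for each element of \<open>H\<close>.\<close>
    have "scale (of_nat (card (orb a))) (A a) = (\<Sum>u\<in>orb a. A a)"
      by (simp add: sum_constant_scale)
    also have "\<dots> = (\<Sum>u\<in>orb a. A u)"
      using A_inv OU[OF a] self[of a] by (intro sum.cong) (auto simp: orb_def)
    also have "\<dots> = (\<Sum>h\<in>H. \<Sum>u\<in>orb a. h u)"
      unfolding A_def by (rule sum.swap)
    also have "\<dots> = (\<Sum>h\<in>H. \<Sum>u\<in>orb a. u)"
    proof (rule sum.cong[OF refl])
      fix h assume "h \<in> H"
      then obtain k where k: "k \<in> K" "h = restrict (\<pi> k) U" by (auto simp: H_def)
      have "(\<Sum>u\<in>orb a. h u) = (\<Sum>u\<in>orb a. \<pi> k u)"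
        using k OU[OF a] by (intro sum.cong) auto
      also have "\<dots> = (\<Sum>u\<in>orb a. u)"
        using sum.reindex_bij_betw[OF bijO[OF k(1)], of "\<lambda>u. u"] by simp
      finally show "(\<Sum>u\<in>orb a. h u) = (\<Sum>u\<in>orb a. u)" .
    qed
    also have "\<dots> \<in> M"
      using subspace_sum[OF M, of H "\<lambda>_. \<Sum>u\<in>orb a. u"] orbit_sum[of a] a t(2)
      by (auto simp: orb_def)
    finally have "scale (inverse (of_nat (card (orb a)))) (scale (of_nat (card (orb a))) (A a)) \<in> M"
      using M subspace_scale by blast
    moreover have "card (orb a) \<noteq> 0" using finO[OF a] self[of a] by auto
    ultimately show ?thesis by simp
  qed
  \<comment> \<open>As \<open>w\<close> is fixed, each \<open>k\<close> reproduces \<open>w\<close>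
    when applied to the expansion over \<open>t\<close>; the basis vectors \<open>a\<close> lie in
    \<open>U\<close>, where \<open>h\<close> agrees with \<pi> \<open>k\<close>.\<close>
  have "scale (of_nat (card H)) w = (\<Sum>h\<in>H. w)" by (simp add: sum_constant_scale)
  also have "\<dots> = (\<Sum>h\<in>H. \<Sum>a\<in>t. scale (c a) (h a))"
  proof (rule sum.cong[OF refl])
    fix h assume "h \<in> H"
    then obtain k where k: "k \<in> K" "h = restrict (\<pi> k) U" by (auto simp: H_def)
    have "w = \<pi> k w" using w(2) k by (simp add: fixed_vectors_def)
    also have "\<dots> = (\<Sum>a\<in>t. scale (c a) (\<pi> k a))"
      using k by (simp add: t(3) rep_sum rep_scale)
    also have "\<dots> = (\<Sum>a\<in>t. scale (c a) (h a))"
      using k OU self by (intro sum.cong) auto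
    finally show "w = (\<Sum>a\<in>t. scale (c a) (h a))" .
  qed
  also have "\<dots> = (\<Sum>a\<in>t. scale (c a) (A a))"
    by (subst sum.swap) (simp add: A_def scale_sum_right)
  also have "\<dots> \<in> M" using A_M M by (intro subspace_sum subspace_scale)
  finally have "scale (inverse (of_nat (card H))) (scale (of_nat (card H)) w) \<in> M"
    using M subspace_scale by blast
  then show ?thesis using cardH by simp
qed

lemma irreducible_if_fixed_vectors_line:
  assumes compl: has_invariant_complements
    and K: "K \<subseteq> carrier G"
    and v: "v \<in> fixed_vectors K" "v \<noteq> 0"
    and cyclic: "span ((\<lambda>g. \<pi> g v) ` carrier G) = UNIV"
    and line: "fixed_vectors K \<subseteq> span {v}"
  shows irreducible
proof -
  have full: "W = UNIV" if W: "invariant_subspace W" "v \<in> W" for W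
  proof -
    have "span ((\<lambda>g. \<pi> g v) ` carrier G) \<subseteq> W"
      using W by (intro span_minimal) (auto simp: invariant_subspace_def)
    then show ?thesis using cyclic by auto
  qed
  have "W = {0} \<or> W = UNIV" if W: "invariant_subspace W" for W
  proof -
    obtain W' where W': "invariant_subspace W'" "W \<inter> W' = {0}"
        "{w + w' | w w'. w \<in> W \<and> w' \<in> W'} = UNIV"
      using compl W unfolding has_invariant_complements_def by meson
    have "v \<in> {w + w' | w w'. w \<in> W \<and> w' \<in> W'}" unfolding W'(3) by simp
    then obtain w w' where ww: "w \<in> W" "w' \<in> W'" "v = w + w'" by blast
    have sub: "subspace W" "subspace W'" using W W' by (auto simp: invariant_subspace_def)
    have "\<pi> k w = w" if k: "k \<in> K" for k
    proof -
      have kG: "k \<in> carrier G" using k K by auto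
      have mem: "\<pi> k w \<in> W" "\<pi> k w' \<in> W'"
        using kG W W' ww by (auto simp: invariant_subspace_def)
      have "\<pi> k w + \<pi> k w' = w + w'"
        using v(1) k ww(3) by (simp add: fixed_vectors_def flip: rep_add[OF kG])
      \<comment> \<open>The left side lies in \<open>W\<close> and the right side in
        \<open>W'\<close>, so both vanish: the component of a fixed vector is fixed.\<close>
      then have eq: "\<pi> k w - w = w' - \<pi> k w'" by (simp add: algebra_simps)
      have "\<pi> k w - w \<in> W" "w' - \<pi> k w' \<in> W'"
        using mem ww sub by (auto intro: subspace_diff)
      then have "\<pi> k w - w \<in> W \<inter> W'" using eq by simp
      then show ?thesis using W'(2) by simp
    qed
    then have "w \<in> span {v}" using line by (auto simp: fixed_vectors_def)
    then obtain c where c: "w = scale c v" by (auto simp: span_singleton)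
    show ?thesis
    \<comment> \<open>If \<open>c = 0\<close> then \<open>v\<close> lies in \<open>W'\<close>, which
      is then everything and forces \<open>W = {0}\<close>; otherwise \<open>v\<close> lies in
      \<open>W\<close>.\<close>
    proof (cases "c = 0")
      case True
      then have "w = 0" by (simp add: c)
      then have "v \<in> W'" using ww(2,3) by simp
      then have "W' = UNIV" by (rule full[OF W'(1)])
      then show ?thesis using W'(2) by simp
    next
      case False
      then have "scale (inverse c) w = v" by (simp add: c)
      then have "v \<in> W" using subspace_scale[OF sub(1) ww(1), of "inverse c"] by simp
      then show ?thesis using full[OF W] by simp
    qed
  qed
  then show ?thesis using v(2) by (auto simp: irreducible_def)
qed

end

section \<open>Hecke operators of double cosets and the line of fixed vectors\<close>

locale rep_haar = td_group G T + left_haar_measure G T \<mu> + representation G scale \<pi>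
  for G (structure) and T and \<mu> and scale :: "complex \<Rightarrow> 'v::ab_group_add \<Rightarrow> 'v" and \<pi>
begin

text \<open>The Hecke operator of the indicator function of \<open>KgK\<close> maps \<open>v\<close> to a positive multiple of the
  sum over the \<open>K\<close>-orbit of \<open>\<pi>(g) v\<close>: by left invariance all level sets of \<open>x \<mapsto> \<pi>(x) v\<close> on \<open>KgK\<close>
  have the same measure.\<close>

lemma hecke_action_double_coset:
  assumes K: "open_compact_subgroup G T K"
    and v: "v \<in> fixed_vectors K" "v \<noteq> 0"
    and g: "g \<in> carrier G"
  obtains f m where "f \<in> carrier (hecke_algebra G T \<mu> K)" "m > 0"
    "finite ((\<lambda>k. \<pi> k (\<pi> g v)) ` K)"
    "hecke_action \<mu> f v = scale (of_real m) (\<Sum>u\<in>(\<lambda>k. \<pi> k (\<pi> g v)) ` K. u)"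
proof -
  have KG: "subgroup K G" and Kop: "openin T K" and Kc: "compactin T K"
    using K by (auto simp: open_compact_subgroup_def)
  interpret K: subgroup K G by (rule KG)
  define D where "D = (\<lambda>(x, y). x \<otimes> (g \<otimes> y)) ` (K \<times> K)"
  define orb where "orb = (\<lambda>k. \<pi> k (\<pi> g v)) ` K"
  define L where "L u = {x \<in> D. \<pi> x v = u}" for u
  define f :: "'a \<Rightarrow> complex" where "f x = (if x \<in> D then 1 else 0)" for x
  have DG: "D \<subseteq> carrier G" using g by (auto simp: D_def)
  have Dcompact: "compactin T D" unfolding D_def by (rule compactin_double_coset[OF g Kc Kc])
  have D_left: "k \<otimes> x \<in> D" if "k \<in> K" "x \<in> D" for k x
  proof -
    obtain a b where ab: "a \<in> K" "b \<in> K" "x = a \<otimes> (g \<otimes> b)" using \<open>x \<in> D\<close> by (auto simp: D_def)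
    then have "k \<otimes> x = (k \<otimes> a) \<otimes> (g \<otimes> b)" using that g by (simp add: m_assoc)
    then show ?thesis using ab that by (force simp: D_def)
  qed
  have D_right: "x \<otimes> k \<in> D" if "k \<in> K" "x \<in> D" for k x
  proof -
    obtain a b where ab: "a \<in> K" "b \<in> K" "x = a \<otimes> (g \<otimes> b)" using \<open>x \<in> D\<close> by (auto simp: D_def)
    then have "x \<otimes> k = a \<otimes> (g \<otimes> (b \<otimes> k))" using that g by (simp add: m_assoc)
    then show ?thesis using ab that by (force simp: D_def)
  qed
  have D_left_iff: "k \<otimes> x \<in> D \<longleftrightarrow> x \<in> D" if "k \<in> K" "x \<in> carrier G" for k x
    using that D_left[of k x] D_left[of "inv k" "k \<otimes> x"] by (auto simp: m_assoc[symmetric])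
  have D_right_iff: "x \<otimes> k \<in> D \<longleftrightarrow> x \<in> D" if "k \<in> K" "x \<in> carrier G" for k x
    using that D_right[of k x] D_right[of "inv k" "x \<otimes> k"] by (auto simp: m_assoc)
  have supp: "{x. f x \<noteq> 0} = D" by (auto simp: f_def)
  \<comment> \<open>The Hecke algebra asks for a compact closure of the support; in a Hausdorff
    space the compact set \<open>D\<close> is already closed.\<close>
  have "T closure_of D = D"
    using compactin_imp_closedin[OF hausdorff Dcompact] closure_of_closedin by blast
  then have fH: "f \<in> carrier (hecke_algebra G T \<mu> K)"
    using DG Dcompact D_left_iff D_right_iff
    by (simp add: hecke_algebra_def supp) (simp add: f_def)

  have value_mem: "\<pi> x v \<in> orb" if "x \<in> D" for x
  proof -
    obtain a b where ab: "a \<in> K" "b \<in> K" "x = a \<otimes> (g \<otimes> b)" using \<open>x \<in> D\<close> by (auto simp: D_def)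
    then have "\<pi> x v = \<pi> a (\<pi> g (\<pi> b v))" using g by (simp add: rep_mult)
    then show ?thesis using ab v(1) by (auto simp: orb_def fixed_vectors_def)
  qed
  have orb_elim: "\<exists>k\<in>K. u = \<pi> k (\<pi> g v)" if "u \<in> orb" for u
    using that by (auto simp: orb_def)
  have in_D: "k \<otimes> g \<in> D" if "k \<in> K" for k
    using that g K.one_closed by (force simp: D_def intro!: image_eqI[of _ _ "(k, \<one>)"])
  have L_ne: "L u \<noteq> {}" if "u \<in> orb" for u
  proof -
    obtain k where k: "k \<in> K" "u = \<pi> k (\<pi> g v)" using orb_elim \<open>u \<in> orb\<close> by blast
    then have "k \<otimes> g \<in> L u" using in_D g by (simp add: L_def rep_mult)
    then show ?thesis by auto
  qed
  \<comment> \<open>Since \<open>K\<close> fixes \<open>v\<close>, each level set is a union of open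
    left cosets \<open>x <# K\<close>.\<close>
  have L_open: "openin T (L u)" for u
  proof (subst openin_subopen, intro ballI)
    fix x assume x: "x \<in> L u"
    then have xG: "x \<in> carrier G" using DG by (auto simp: L_def)
    have "openin T (x <# K)" using openin_l_coset[OF xG Kop] .
    moreover have "x \<in> x <# K" using xG K.one_closed by (force simp: l_coset_def)
    moreover have "x <# K \<subseteq> L u"
      using x xG D_right v(1) by (auto simp: l_coset_def L_def rep_mult fixed_vectors_def)
    ultimately show "\<exists>S. openin T S \<and> x \<in> S \<and> S \<subseteq> L u" by blast
  qed
  have L_sets: "L u \<in> sets \<mu>" for u using L_open openin_sets by blast
  \<comment> \<open>The level sets are disjoint, nonempty and open and cover the compact
    \<open>D\<close>, so a finite subcover must contain all of them.\<close>
  have finO: "finite orb"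
  proof -
    have "D \<subseteq> \<Union>(L ` orb)" using value_mem by (auto simp: L_def)
    then obtain \<F> where \<F>: "finite \<F>" "\<F> \<subseteq> L ` orb" "D \<subseteq> \<Union>\<F>"
      using Dcompact[unfolded compactin_def] L_open
      by (elim conjE allE[of _ "L ` orb"]) auto
    obtain Q where Q: "finite Q" "Q \<subseteq> orb" "\<F> = L ` Q"
      using \<F> finite_subset_image by metis
    have "orb \<subseteq> Q"
    proof
      fix u assume "u \<in> orb"
      then obtain x where x: "x \<in> D" "\<pi> x v = u" using L_ne by (fastforce simp: L_def)
      then show "u \<in> Q" using \<F>(3) Q(3) by (auto simp: L_def)
    qed
    then show ?thesis using Q finite_subset by blast
  qed
  define m where "m = measure \<mu> (L (\<pi> g v))"
  have base: "\<pi> g v \<in> orb"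
    unfolding orb_def by (rule image_eqI[OF _ K.one_closed]) (simp add: rep_one)
  \<comment> \<open>Finiteness is needed as well as positivity, because \<open>measure\<close> sends
    infinite measure to 0.\<close>
  have "m > 0"
  proof -
    have "emeasure \<mu> D < \<infinity>" by (rule finite_on_compact[OF Dcompact])
    moreover have "D \<in> sets \<mu>"
    proof -
      have "D = (\<Union>u\<in>orb. L u)" using value_mem by (auto simp: L_def)
      then show ?thesis using finO L_sets by auto
    qed
    ultimately have "emeasure \<mu> (L (\<pi> g v)) < \<infinity>"
      using emeasure_mono[of "L (\<pi> g v)" D \<mu>] by (force simp: L_def)
    moreover have "emeasure \<mu> (L (\<pi> g v)) > 0"
      using emeasure_open_pos[OF L_open L_ne[OF base]] .
    ultimately show ?thesis unfolding m_def measure_def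
      by (simp add: enn2real_positive_iff)
  qed
  have meas: "measure \<mu> (L u) = m" if "u \<in> orb" for u
  proof -
    obtain k where k: "k \<in> K" "u = \<pi> k (\<pi> g v)" using orb_elim \<open>u \<in> orb\<close> by blast
    have "L u = k <# L (\<pi> g v)"
    proof (intro equalityI subsetI)
      fix x assume x: "x \<in> L u"
      then have xG: "x \<in> carrier G" using DG by (auto simp: L_def)
      have "inv k \<otimes> x \<in> L (\<pi> g v)"
        using x xG k D_left by (simp add: L_def rep_mult rep_inverse)
      moreover have "x = k \<otimes> (inv k \<otimes> x)" using k xG by (simp add: m_assoc[symmetric])
      ultimately show "x \<in> k <# L (\<pi> g v)" by (auto simp: l_coset_def)
    next
      fix x assume "x \<in> k <# L (\<pi> g v)"
      then show "x \<in> L u" using k D_left DG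
        by (auto simp: l_coset_def L_def rep_mult subset_eq)
    qed
    then show ?thesis
      using left_invariant[OF K.mem_carrier[OF k(1)] L_sets] by (simp add: m_def measure_def)
  qed
  \<comment> \<open>The integrand vanishes exactly off \<open>D\<close>. Hence discarding the value
    0 in \<open>vector_integral\<close> leaves precisely the orbit, with the sets \<open>L u\<close>
    as level sets.\<close>
  have nz: "\<pi> x v \<noteq> 0" if "x \<in> carrier G" for x using that v(2) rep_eq_zero_iff by simp
  have orb_nz: "u \<noteq> 0" if "u \<in> orb" for u
    using L_ne[OF that] nz DG by (auto simp: L_def)
  have level: "{x \<in> space \<mu>. scale (f x) (\<pi> x v) = u} = L u" if "u \<in> orb" for u
    using orb_nz[OF that] DG by (auto simp: L_def f_def space_eq)
  have range: "(\<lambda>x. scale (f x) (\<pi> x v)) ` space \<mu> - {0} = orb"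
  proof (intro equalityI subsetI)
    fix u assume "u \<in> (\<lambda>x. scale (f x) (\<pi> x v)) ` space \<mu> - {0}"
    then show "u \<in> orb" using value_mem by (auto simp: f_def split: if_splits)
  next
    fix u assume u: "u \<in> orb"
    then have "{x \<in> space \<mu>. scale (f x) (\<pi> x v) = u} \<noteq> {}" using level L_ne by simp
    then show "u \<in> (\<lambda>x. scale (f x) (\<pi> x v)) ` space \<mu> - {0}" using orb_nz[OF u] by auto
  qed
  have "hecke_action \<mu> f v = (\<Sum>u\<in>orb. scale (of_real m) u)"
    unfolding hecke_action_def vector_integral_def range
    by (intro sum.cong refl) (simp add: level meas)
  also have "\<dots> = scale (of_real m) (\<Sum>u\<in>orb. u)" by (simp add: scale_sum_right)
  finally show thesis using that[OF fH \<open>m > 0\<close>] finO by (simp add: orb_def)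
qed

text \<open>The eigenvector property puts every orbit sum of a spanning vector into
  \<open>span {v}\<close>, so \<open>fixed_vector_in_subspace\<close> applies with this line as
  \<open>M\<close>.\<close>

lemma fixed_vectors_eq_line:
  assumes K: "open_compact_subgroup G T K"
    and v: "v \<noteq> 0" "hecke_eigenvector T \<mu> K v"
    and cyclic: "span ((\<lambda>g. \<pi> g v) ` carrier G) = UNIV"
  shows "fixed_vectors K \<subseteq> span {v}"
proof
  fix w assume w: "w \<in> fixed_vectors K"
  have vK: "v \<in> fixed_vectors K" using v(2) by (simp add: hecke_eigenvector_def)
  show "w \<in> span {v}"
  proof (rule fixed_vector_in_subspace[where B = "(\<lambda>g. \<pi> g v) ` carrier G"])
    show "subgroup K G" using K by (simp add: open_compact_subgroup_def)
    show "w \<in> span ((\<lambda>g. \<pi> g v) ` carrier G)" using cyclic by simp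
    fix b assume "b \<in> (\<lambda>g. \<pi> g v) ` carrier G"
    then obtain g where g: "g \<in> carrier G" "b = \<pi> g v" by auto
    obtain f m where fm: "f \<in> carrier (hecke_algebra G T \<mu> K)" "m > 0"
      "finite ((\<lambda>k. \<pi> k b) ` K)"
      "hecke_action \<mu> f v = scale (of_real m) (\<Sum>u\<in>(\<lambda>k. \<pi> k b) ` K. u)"
      using hecke_action_double_coset[OF K vK v(1) g(1)] unfolding g(2) by blast
    show "finite ((\<lambda>k. \<pi> k b) ` K)" by fact
    obtain c where "hecke_action \<mu> f v = scale c v"
      using v(2) fm(1) by (auto simp: hecke_eigenvector_def)
    \<comment> \<open>Dividing by the nonzero \<open>m\<close> recovers the orbit sum from the Hecke
      operator.\<close>
    then have "scale (inverse (of_real m)) (scale (of_real m) (\<Sum>u\<in>(\<lambda>k. \<pi> k b) ` K. u)) \<in> span {v}"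
      using fm(4) by (simp add: span_base span_scale)
    then show "(\<Sum>u\<in>(\<lambda>k. \<pi> k b) ` K. u) \<in> span {v}" using fm(2) by simp
  qed (use w subspace_span in auto)
qed

end

theorem proposition1p2:
  fixes G :: "('g, 'm) monoid_scheme" and T :: "'g topology" and \<mu> :: "'g measure"
    and scale :: "complex \<Rightarrow> 'v::ab_group_add \<Rightarrow> 'v" and \<pi> :: "'g \<Rightarrow> 'v \<Rightarrow> 'v"
    and K :: "'g set" and v\<^sub>0 :: 'v
  assumes "td_group G T"
    and "left_haar_measure G T \<mu>"
    and "smooth_representation G scale \<pi> T"
    and "representation.has_invariant_complements G scale \<pi>"
    and "open_compact_subgroup G T K"
    and "v\<^sub>0 \<in> representation.fixed_vectors \<pi> K"
    and "v\<^sub>0 \<noteq> 0"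
    and "module.span scale ((\<lambda>g. \<pi> g v\<^sub>0) ` carrier G) = UNIV"
    and "representation.hecke_eigenvector G scale \<pi> T \<mu> K v\<^sub>0"
  shows "representation.irreducible G scale \<pi>"
proof -
  interpret td_group G T by fact
  interpret left_haar_measure G T \<mu> by fact
  interpret smooth_representation G scale \<pi> T by fact
  interpret rep_haar G T \<mu> scale \<pi> ..
  have "K \<subseteq> carrier G"
    using assms(5) subgroup.subset by (auto simp: open_compact_subgroup_def)
  then show ?thesis
    using irreducible_if_fixed_vectors_line fixed_vectors_eq_line assms by blast
qed

end
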